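(* Let $\pi$ be a probability distribution on a countable set $\mathcal{K}$, and let $\bar\Pi(\cdot|X)$ be the hierarchical Bayes posterior on the common parameter space $\Xi=\bigcup_{k\in\mathcal{K}}\Xi_k$, $$d\bar{\Pi}(\xi|X) = \frac{\sum_{k\in\mathcal{K}}\pi(k)\, p(X|\xi)\,d\bar{\Pi}^{(k)}(\xi)}{\sum_{k\in\mathcal{K}}\pi(k)\int p(X|\xi)\,d\bar{\Pi}^{(k)}(\xi)} .$$ Let $\widehat{Q}_{\rm EB}$ be the empirical Bayes posterior on $\Xi$, $$d\widehat{Q}_{\rm EB}(\xi)\propto p(X|\xi)\,d\bar{\Pi}^{(\widehat{k})}(\xi),\qquad \widehat{k}=\mathop{\rm argmax}_{k\in\mathcal{K}}\log\left[\pi(k)\int p(X|\xi)\,d\bar{\Pi}^{(k)}(\xi)\right].$$ Define the class of probability distributions on $\Xi$ $$\mathcal{S}_{\rm EB}=\left\{Q: Q(\Xi_k)=1\text{ for some }k\in\mathcal{K}\right\}.$$ Then $\widehat{Q}_{\rm EB}$ is the variational approximation to the hierarchical Bayes posterior $\bar\Pi(\cdot|X)$ in the class $\mathcal{S}_{\rm EB}$, that is, $$\widehat{Q}_{\rm EB}=\mathop{\rm argmin}_{Q\in\mathcal{S}_{\rm EB}}D\big(Q\,\|\,\bar{\Pi}(\cdot|X)\big).$$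
   Context: $D(P\|Q)=\int\log\frac{dP}{dQ}\,dP$ is the Kullback-Leibler divergence ($+\infty$ if $P\not\ll Q$). Model: $\{P_{k,\theta^{(k)}}:k\in\mathcal{K},\theta^{(k)}\in\Theta^{(k)}\}$ is a statistical model, where $\mathcal{K}$ is a countable set, each $\Theta^{(k)}$ is a (measurable) parameter space, and $P_{k,\theta^{(k)}}$ has likelihood (density with respect to a common dominating measure) $p(X|k,\theta^{(k)})$. For each $k$, $\Pi^{(k)}$ is a prior probability distribution on $\Theta^{(k)}$. No further assumption is made on likelihood or priors. Common parameter space: let $*$ be a symbol outside all $\Theta^{(k)}$ and define $$\Xi_k=\{\xi=(\theta^{(l)})_{l\in\mathcal{K}}:\theta^{(k)}\in\Theta^{(k)}\text{ and }\theta^{(l)}=*\text{ for all }l\in\mathcal{K}\setminus\{k\}\},\qquad \Xi=\bigcup_{k\in\mathcal{K}}\Xi_k .$$ So $\Xi$ is the disjoint union of the $\Xi_k$, and $\Xi_k$ is in bijection with $\Theta^{(k)}$. A subset of $\Xi$ is measurable if its trace on each $\Xi_k\cong\Theta^{(k)}$ is measurable. For $\xi\in\Xi_k$ corresponding to $\theta^{(k)}$, write $p(X|\xi)=p(X|k,\theta^{(k)})$. The distribution $\bar\Pi^{(k)}$ on $\Xi$ is the push-forward of $\Pi^{(k)}$ under $\Theta^{(k)}\cong\Xi_k\subset\Xi$. The data $X$ is such that the hierarchical posterior is well defined: $0<\sum_{k\in\mathcal{K}}\pi(k)\int p(X|\xi)\,d\bar\Pi^{(k)}(\xi)<\infty$.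 If the maximizer defining $\widehat k$ is not unique, $\widehat k$ is any maximizer, and the conclusion means that $\widehat{Q}_{\rm EB}$ attains the minimum. *)

theory Defs
  imports "HOL-Probability.Probability"
begin

section \<open>The common parameter space\<close>

text \<open>
  The parameter spaces are measurable spaces \<open>Theta k\<close> over a common type; they may have different
  carriers and \<open>\<sigma>\<close>-algebras.  The extra symbol \<open>*\<close> is \<open>None\<close>.  Points of the common space are families
  indexed by \<open>K\<close>, hence functions that are \<open>undefined\<close> outside \<open>K\<close>.
\<close>

definition Xi_part :: "'k set \<Rightarrow> ('k \<Rightarrow> 'a measure) \<Rightarrow> 'k \<Rightarrow> ('k \<Rightarrow> 'a option) set" where
  "Xi_part K Theta k =
     {\<xi> \<in> extensional K. \<xi> k \<in> Some ` space (Theta k) \<and> (\<forall>l \<in> K - {k}. \<xi> l = None)}"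

definition Xi_set :: "'k set \<Rightarrow> ('k \<Rightarrow> 'a measure) \<Rightarrow> ('k \<Rightarrow> 'a option) set" where
  "Xi_set K Theta = (\<Union>k\<in>K. Xi_part K Theta k)"

definition Xi_embed :: "'k set \<Rightarrow> 'k \<Rightarrow> 'a \<Rightarrow> ('k \<Rightarrow> 'a option)" where
  "Xi_embed K k \<theta> = (\<lambda>l\<in>K. if l = k then Some \<theta> else None)"

definition Xi_space :: "'k set \<Rightarrow> ('k \<Rightarrow> 'a measure) \<Rightarrow> ('k \<Rightarrow> 'a option) measure" where
  "Xi_space K Theta = sigma (Xi_set K Theta)
     {A. A \<subseteq> Xi_set K Theta \<and> (\<forall>k\<in>K. Xi_embed K k -` A \<inter> space (Theta k) \<in> sets (Theta k))}"

lemma bij_betw_Xi_embed: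
  assumes "k \<in> K"
  shows "bij_betw (Xi_embed K k) (space (Theta k)) (Xi_part K Theta k)"
proof (rule bij_betw_imageI)
  show "inj_on (Xi_embed K k) (space (Theta k))"
    using assms by (auto simp: inj_on_def Xi_embed_def fun_eq_iff split: if_splits)
  show "Xi_embed K k ` space (Theta k) = Xi_part K Theta k"
  proof (intro equalityI subsetI)
    fix \<xi> assume "\<xi> \<in> Xi_part K Theta k"
    then obtain \<theta> where "\<theta> \<in> space (Theta k)" "\<xi> k = Some \<theta>" "\<xi> \<in> extensional K"
      "\<forall>l \<in> K - {k}. \<xi> l = None"
      by (auto simp: Xi_part_def)
    moreover from this have "\<xi> = Xi_embed K k \<theta>"
      by (auto simp: Xi_embed_def fun_eq_iff extensional_def)
    ultimately show "\<xi> \<in> Xi_embed K k ` space (Theta k)" by blast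
  qed (use assms in \<open>auto simp: Xi_part_def Xi_embed_def split: if_splits\<close>)
qed

lemma disjoint_Xi_part: "disjoint_family_on (Xi_part K Theta) K"
  by (fastforce simp: disjoint_family_on_def Xi_part_def)

lemma space_Xi_space [simp]: "space (Xi_space K Theta) = Xi_set K Theta"
  unfolding Xi_space_def by (rule space_measure_of) auto

lemma sets_Xi_space:
  "sets (Xi_space K Theta) =
     {A. A \<subseteq> Xi_set K Theta \<and> (\<forall>k\<in>K. Xi_embed K k -` A \<inter> space (Theta k) \<in> sets (Theta k))}"
  (is "_ = ?S")
proof -
  have emb: "Xi_embed K k \<theta> \<in> Xi_set K Theta" if "k \<in> K" "\<theta> \<in> space (Theta k)" for k \<theta>
    using bij_betwE[OF bij_betw_Xi_embed[OF that(1), of Theta]] that by (auto simp: Xi_set_def)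
  have "sigma_algebra (Xi_set K Theta) ?S"
    unfolding sigma_algebra_iff2
  proof (intro conjI ballI allI impI)
    fix A assume A: "A \<in> ?S"
    have "Xi_embed K k -` (Xi_set K Theta - A) \<inter> space (Theta k)
        = space (Theta k) - (Xi_embed K k -` A \<inter> space (Theta k))" if "k \<in> K" for k
      using emb[OF that] by auto
    with A show "Xi_set K Theta - A \<in> ?S" by auto
  next
    fix A :: "nat \<Rightarrow> _" assume A: "range A \<subseteq> ?S"
    have "Xi_embed K k -` (\<Union>i. A i) \<inter> space (Theta k) \<in> sets (Theta k)" if "k \<in> K" for k
    proof -
      have "Xi_embed K k -` A i \<inter> space (Theta k) \<in> sets (Theta k)" for i
        using A that by blast
      then have "(\<Union>i. Xi_embed K k -` A i \<inter> space (Theta k)) \<in> sets (Theta k)" by blast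
      then show ?thesis by (simp add: vimage_UN)
    qed
    with A show "(\<Union>i. A i) \<in> ?S" by blast
  qed auto
  then show ?thesis
    unfolding Xi_space_def by (simp add: sigma_algebra.sets_measure_of_eq)
qed

lemma measurable_Xi_embed:
  assumes "k \<in> K"
  shows "Xi_embed K k \<in> measurable (Theta k) (Xi_space K Theta)"
proof (rule measurableI)
  show "Xi_embed K k \<theta> \<in> space (Xi_space K Theta)" if "\<theta> \<in> space (Theta k)" for \<theta>
    using bij_betwE[OF bij_betw_Xi_embed[OF assms, of Theta]] that assms by (auto simp: Xi_set_def)
qed (use assms in \<open>auto simp: sets_Xi_space\<close>)


section \<open>Likelihood, priors and posteriors on the common space\<close>

definition Xi_lik :: "'k set \<Rightarrow> ('k \<Rightarrow> 'a \<Rightarrow> 'x \<Rightarrow> real) \<Rightarrow> 'x \<Rightarrow> ('k \<Rightarrow> 'a option) \<Rightarrow> real" where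
  "Xi_lik K p X \<xi> = (let k = (THE k. k \<in> K \<and> \<xi> k \<noteq> None) in p k (the (\<xi> k)) X)"

lemma Xi_lik_Xi_embed:
  assumes "k \<in> K"
  shows "Xi_lik K p X (Xi_embed K k \<theta>) = p k \<theta> X"
proof -
  have "(THE l. l \<in> K \<and> Xi_embed K k \<theta> l \<noteq> None) = k"
    using assms by (intro the_equality) (auto simp: Xi_embed_def split: if_splits)
  then show ?thesis using assms by (simp add: Xi_lik_def Xi_embed_def)
qed

definition prior_bar ::
    "'k set \<Rightarrow> ('k \<Rightarrow> 'a measure) \<Rightarrow> ('k \<Rightarrow> 'a measure) \<Rightarrow> 'k \<Rightarrow> ('k \<Rightarrow> 'a option) measure" where
  "prior_bar K Theta prior k = distr (prior k) (Xi_space K Theta) (Xi_embed K k)"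

definition evidence ::
    "'k set \<Rightarrow> ('k \<Rightarrow> 'a measure) \<Rightarrow> ('k \<Rightarrow> 'a \<Rightarrow> 'x \<Rightarrow> real) \<Rightarrow> 'x \<Rightarrow> ('k \<Rightarrow> 'a measure) \<Rightarrow> 'k \<Rightarrow> ennreal" where
  "evidence K Theta p X prior k = (\<integral>\<^sup>+ \<xi>. ennreal (Xi_lik K p X \<xi>) \<partial>prior_bar K Theta prior k)"

text \<open>
  Sums over \<open>K\<close> are integrals with respect to the counting measure.  An index with \<open>\<pi>(k) = 0\<close>
  contributes nothing, even if its evidence is infinite.
\<close>

definition hier_evidence ::
    "'k set \<Rightarrow> ('k \<Rightarrow> 'a measure) \<Rightarrow> ('k \<Rightarrow> 'a \<Rightarrow> 'x \<Rightarrow> real) \<Rightarrow> 'x \<Rightarrow> ('k \<Rightarrow> 'a measure) \<Rightarrow> 'k pmf \<Rightarrow> ennreal" where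
  "hier_evidence K Theta p X prior \<pi> =
     (\<integral>\<^sup>+ k. ennreal (pmf \<pi> k) * evidence K Theta p X prior k \<partial>count_space K)"

definition hier_posterior ::
    "'k set \<Rightarrow> ('k \<Rightarrow> 'a measure) \<Rightarrow> ('k \<Rightarrow> 'a \<Rightarrow> 'x \<Rightarrow> real) \<Rightarrow> 'x \<Rightarrow> ('k \<Rightarrow> 'a measure) \<Rightarrow> 'k pmf \<Rightarrow>
     ('k \<Rightarrow> 'a option) measure" where
  "hier_posterior K Theta p X prior \<pi> =
     measure_of (Xi_set K Theta) (sets (Xi_space K Theta))
       (\<lambda>A. (\<integral>\<^sup>+ k. ennreal (pmf \<pi> k) *
                  (\<integral>\<^sup>+ \<xi>\<in>A. ennreal (Xi_lik K p X \<xi>) \<partial>prior_bar K Theta prior k) \<partial>count_space K)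
            / hier_evidence K Theta p X prior \<pi>)"

lemma measurable_Xi_lik:
  assumes "\<And>k. k \<in> K \<Longrightarrow> (\<lambda>\<theta>. p k \<theta> X) \<in> borel_measurable (Theta k)"
  shows "Xi_lik K p X \<in> borel_measurable (Xi_space K Theta)"
proof (rule measurableI)
  fix B :: "real set" assume B: "B \<in> sets borel"
  have "Xi_embed K k -` (Xi_lik K p X -` B \<inter> Xi_set K Theta) \<inter> space (Theta k)
      = (\<lambda>\<theta>. p k \<theta> X) -` B \<inter> space (Theta k)" if "k \<in> K" for k
    using bij_betwE[OF bij_betw_Xi_embed[OF that, of Theta]] that
    by (auto simp: Xi_lik_Xi_embed Xi_set_def)
  with B assms show "Xi_lik K p X -` B \<inter> space (Xi_space K Theta) \<in> sets (Xi_space K Theta)"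
    by (auto simp: sets_Xi_space intro: measurable_sets)
qed simp

text \<open>The set function in the definition of the posterior really is a measure.\<close>

lemma emeasure_hier_posterior:
  assumes "\<And>k. k \<in> K \<Longrightarrow> (\<lambda>\<theta>. p k \<theta> X) \<in> borel_measurable (Theta k)"
    and A: "A \<in> sets (Xi_space K Theta)"
  shows "emeasure (hier_posterior K Theta p X prior \<pi>) A =
    (\<integral>\<^sup>+ k. ennreal (pmf \<pi> k) *
        (\<integral>\<^sup>+ \<xi>\<in>A. ennreal (Xi_lik K p X \<xi>) \<partial>prior_bar K Theta prior k) \<partial>count_space K)
      / hier_evidence K Theta p X prior \<pi>"
proof -
  note [measurable] = measurable_Xi_lik[of K p X Theta, OF assms(1)]
  have [simp, measurable_cong]: "sets (prior_bar K Theta prior k) = sets (Xi_space K Theta)" for k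
    by (simp add: prior_bar_def)
  let ?I = "\<lambda>k B. \<integral>\<^sup>+ \<xi>\<in>B. ennreal (Xi_lik K p X \<xi>) \<partial>prior_bar K Theta prior k"
  let ?m = "\<lambda>B. (\<integral>\<^sup>+ k. ennreal (pmf \<pi> k) * ?I k B \<partial>count_space K) / hier_evidence K Theta p X prior \<pi>"
  have "countably_additive (sets (Xi_space K Theta)) ?m"
  proof (rule countably_additiveI)
    fix B :: "nat \<Rightarrow> _"
    assume B: "range B \<subseteq> sets (Xi_space K Theta)" "disjoint_family B"
    then have [measurable]: "B i \<in> sets (Xi_space K Theta)" for i by auto
    have I: "?I k (\<Union>i. B i) = (\<Sum>i. ?I k (B i))" for k
    proof -
      have "?I k (\<Union>i. B i) = (\<integral>\<^sup>+ \<xi>. (\<Sum>i. ennreal (Xi_lik K p X \<xi>) * indicator (B i) \<xi>)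
              \<partial>prior_bar K Theta prior k)"
        by (simp only: ennreal_suminf_cmult suminf_indicator[OF B(2)])
      also have "\<dots> = (\<Sum>i. ?I k (B i))" by (rule nn_integral_suminf) measurable
      finally show ?thesis .
    qed
    have "(\<integral>\<^sup>+ k. ennreal (pmf \<pi> k) * ?I k (\<Union>i. B i) \<partial>count_space K)
        = (\<Sum>i. \<integral>\<^sup>+ k. ennreal (pmf \<pi> k) * ?I k (B i) \<partial>count_space K)"
      unfolding I by (simp flip: nn_integral_suminf)
    then show "(\<Sum>i. ?m (B i)) = ?m (\<Union>i. B i)" by (simp add: divide_ennreal_def)
  qed
  moreover have "positive (sets (Xi_space K Theta)) ?m" by (simp add: positive_def)
  ultimately show ?thesis
    unfolding hier_posterior_def
    using emeasure_measure_of_sigma[of "Xi_set K Theta" "sets (Xi_space K Theta)" ?m A] A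
      sets.sigma_algebra_axioms[of "Xi_space K Theta"]
    by simp
qed

definition EB_posterior ::
    "'k set \<Rightarrow> ('k \<Rightarrow> 'a measure) \<Rightarrow> ('k \<Rightarrow> 'a \<Rightarrow> 'x \<Rightarrow> real) \<Rightarrow> 'x \<Rightarrow> ('k \<Rightarrow> 'a measure) \<Rightarrow> 'k \<Rightarrow>
     ('k \<Rightarrow> 'a option) measure" where
  "EB_posterior K Theta p X prior k =
     density (prior_bar K Theta prior k)
       (\<lambda>\<xi>. ennreal (Xi_lik K p X \<xi>) / evidence K Theta p X prior k)"

definition ln_ennreal :: "ennreal \<Rightarrow> ereal" where
  "ln_ennreal x = (if x = 0 then -\<infinity> else if x = \<infinity> then \<infinity> else ereal (ln (enn2real x)))"

definition EB_objective ::
    "'k set \<Rightarrow> ('k \<Rightarrow> 'a measure) \<Rightarrow> ('k \<Rightarrow> 'a \<Rightarrow> 'x \<Rightarrow> real) \<Rightarrow> 'x \<Rightarrow> ('k \<Rightarrow> 'a measure) \<Rightarrow> 'k pmf \<Rightarrow> 'k \<Rightarrow> ereal" where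
  "EB_objective K Theta p X prior \<pi> k =
     ln_ennreal (ennreal (pmf \<pi> k) * evidence K Theta p X prior k)"

definition S_EB :: "'k set \<Rightarrow> ('k \<Rightarrow> 'a measure) \<Rightarrow> ('k \<Rightarrow> 'a option) measure set" where
  "S_EB K Theta = {Q. prob_space Q \<and> sets Q = sets (Xi_space K Theta) \<and>
                      (\<exists>k\<in>K. measure Q (Xi_part K Theta k) = 1)}"


section \<open>Kullback--Leibler divergence\<close>

text \<open>
  \<open>D(P || Q)\<close> with values in the extended reals, for probability measures on the same
  \<open>\<sigma>\<close>-algebra.  \<^const>\<open>KL_divergence\<close> takes its arguments in the opposite order, and is
  \<open>0\<close> when the integral diverges; here the integral is the difference of the integrals of the
  positive and negative parts (\<^const>\<open>ennreal\<close> truncates at \<open>0\<close>), the latter being always finite.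
\<close>

definition KL_ereal :: "'b measure \<Rightarrow> 'b measure \<Rightarrow> ereal" where
  "KL_ereal P Q =
     (if absolutely_continuous Q P
      then enn2ereal (\<integral>\<^sup>+ x. ennreal (ln (enn2real (RN_deriv Q P x))) \<partial>P)
         - enn2ereal (\<integral>\<^sup>+ x. ennreal (- ln (enn2real (RN_deriv Q P x))) \<partial>P)
      else \<infinity>)"

lemma KL_ereal_eq_KL_divergence:
  assumes "absolutely_continuous Q P" "integrable P (entropy_density (exp 1) Q P)"
  shows "KL_ereal P Q = ereal (KL_divergence (exp 1) Q P)"
proof -
  have *: "entropy_density (exp 1) Q P = (\<lambda>x. ln (enn2real (RN_deriv Q P x)))"
    by (simp add: entropy_density_def log_def fun_eq_iff)
  let ?p = "\<integral>\<^sup>+ x. ennreal (ln (enn2real (RN_deriv Q P x))) \<partial>P"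
  let ?n = "\<integral>\<^sup>+ x. ennreal (- ln (enn2real (RN_deriv Q P x))) \<partial>P"
  have "(\<integral>x. ln (enn2real (RN_deriv Q P x)) \<partial>P) = enn2real ?p - enn2real ?n"
    using real_lebesgue_integral_def[OF assms(2)] unfolding * .
  moreover have "enn2ereal ?p = ereal (enn2real ?p)" "enn2ereal ?n = ereal (enn2real ?n)"
    using assms(2) unfolding *
    by (auto simp: real_integrable_def simp flip: enn2ereal_ennreal less_top)
  ultimately show ?thesis using assms(1)
    by (simp add: KL_ereal_def KL_divergence_def *)
qed

end

theory Submission
  imports Defs
begin

text \<open>
  If \<open>Q\<close> is concentrated on an event \<open>B\<close>, then \<open>D(Q || H) \<ge> - ln H(B)\<close>, with equality exactly for the
  conditional distribution \<open>H(\<cdot> | B)\<close>.  For the hierarchical posterior \<open>H\<close>, the probability of \<open>\<Xi>\<^sub>k\<close> is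
  proportional to \<open>\<pi>(k)\<close> times the evidence of \<open>k\<close>, and \<open>H(\<cdot> | \<Xi>\<^sub>k)\<close> is the posterior within model \<open>k\<close>.
  Minimising over \<open>Q\<close> is therefore maximising \<open>H(\<Xi>\<^sub>k)\<close> over \<open>k\<close>.
\<close>

section \<open>Order of the extended logarithm and equality of probability measures\<close>

lemma ln_ennreal_less_iff [simp]: "ln_ennreal x < ln_ennreal y \<longleftrightarrow> x < y"
  by (cases x rule: ennreal_cases; cases y rule: ennreal_cases)
    (auto simp: ln_ennreal_def top_unique ennreal_less_iff)

lemma ln_ennreal_le_iff [simp]: "ln_ennreal x \<le> ln_ennreal y \<longleftrightarrow> x \<le> y"
  using ln_ennreal_less_iff[of y x] by (simp only: not_less[symmetric])

lemma ln_ennreal_eq_infty_iff: "- ln_ennreal x = \<infinity> \<longleftrightarrow> x = 0"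
  by (simp add: ln_ennreal_def)

text \<open>Both total masses are \<open>1\<close>, so the inequality for the complement of
  \<open>A\<close> gives the reverse inequality for \<open>A\<close>. An upper bound alone then
  identifies a measure.\<close>

lemma prob_measure_eqI_le:
  assumes "prob_space M" "prob_space N" and sets: "sets M = sets N"
    and le: "\<And>A. A \<in> sets M \<Longrightarrow> emeasure M A \<le> emeasure N A"
  shows "M = N"
proof (rule measure_eqI[OF sets])
  interpret M: prob_space M by fact
  interpret N: prob_space N by fact
  fix A assume A: "A \<in> sets M"
  have *: "M.prob B \<le> N.prob B" if "B \<in> sets M" for B
    using le[OF that] by (simp add: M.emeasure_eq_measure N.emeasure_eq_measure)
  have "M.prob (space M - A) = 1 - M.prob A" "N.prob (space M - A) = 1 - N.prob A"
    using A sets sets_eq_imp_space_eq[OF sets] M.prob_compl N.prob_compl by auto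
  then have "M.prob A = N.prob A"
    using *[of A] *[of "space M - A"] A by auto
  then show "emeasure M A = emeasure N A"
    by (simp add: M.emeasure_eq_measure N.emeasure_eq_measure)
qed


section \<open>Relative entropy of a measure concentrated on an event\<close>

text \<open>The conditional distribution given \<open>B\<close>, written as a density so that its
  Radon-Nikodym derivative is explicit. If \<open>B\<close> is null it is the zero measure.\<close>

definition cond_measure :: "'a measure \<Rightarrow> 'a set \<Rightarrow> 'a measure" where
  "cond_measure H B = density H (\<lambda>x. indicator B x / emeasure H B)"

lemma sets_cond_measure [simp, measurable_cong]: "sets (cond_measure H B) = sets H"
  by (simp add: cond_measure_def)

lemma space_cond_measure [simp]: "space (cond_measure H B) = space H"
  by (simp add: cond_measure_def)

lemma emeasure_cond_measure:
  assumes [measurable]: "A \<in> sets H" "B \<in> sets H"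
  shows "emeasure (cond_measure H B) A = emeasure H (A \<inter> B) / emeasure H B"
proof -
  have "emeasure (cond_measure H B) A
      = (\<integral>\<^sup>+x. inverse (emeasure H B) * indicator (A \<inter> B) x \<partial>H)"
    by (auto simp: cond_measure_def emeasure_density divide_ennreal_def
        intro!: nn_integral_cong split: split_indicator)
  then show ?thesis
    by (simp add: nn_integral_cmult divide_ennreal_def mult.commute)
qed

context prob_space
begin

lemma prob_space_cond_measure:
  assumes "B \<in> events" "emeasure M B \<noteq> 0"
  shows "prob_space (cond_measure M B)"
proof
  show "emeasure (cond_measure M B) (space (cond_measure M B)) = 1"
    using assms by (simp add: emeasure_cond_measure Int_absorb1 sets.sets_into_space less_top[symmetric])
qed

text \<open>The density is the constant \<open>1 / prob B\<close> on \<open>B\<close>, and the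
  complement of \<open>B\<close> has no mass under the conditional distribution, so the integrand is
  almost everywhere constant.\<close>

lemma KL_ereal_cond_measure:
  assumes [measurable]: "B \<in> events" and B: "emeasure M B \<noteq> 0"
  shows "KL_ereal (cond_measure M B) M = - ln_ennreal (emeasure M B)"
proof -
  interpret C: prob_space "cond_measure M B"
    using assms by (rule prob_space_cond_measure)
  have pos: "0 < prob B" and le: "prob B \<le> 1"
    using B by (auto simp: emeasure_eq_measure less_le)
  have ac: "absolutely_continuous M (cond_measure M B)"
    unfolding cond_measure_def by (rule absolutely_continuousI_density) measurable
  have "AE x in M. indicator B x / emeasure M B = RN_deriv M (cond_measure M B) x"
    by (rule RN_deriv_unique) (auto simp: cond_measure_def)
  then have "AE x in cond_measure M B. enn2real (RN_deriv M (cond_measure M B) x) = 1 / prob B"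
    unfolding cond_measure_def[of M B]
    by (subst AE_density)
      (auto elim!: eventually_mono split: split_indicator
        simp: emeasure_eq_measure divide_ennreal ennreal_1[symmetric] pos simp del: ennreal_1)
  then have AE: "AE x in cond_measure M B.
      ln (enn2real (RN_deriv M (cond_measure M B) x)) = - ln (prob B)"
    using pos by (auto elim!: eventually_mono simp: ln_div)
  have "(\<integral>\<^sup>+x. ennreal (ln (enn2real (RN_deriv M (cond_measure M B) x))) \<partial>cond_measure M B)
      = (\<integral>\<^sup>+x. ennreal (- ln (prob B)) \<partial>cond_measure M B)"
    by (rule nn_integral_cong_AE) (use AE in \<open>auto elim!: eventually_mono\<close>)
  moreover have "(\<integral>\<^sup>+x. ennreal (- ln (enn2real (RN_deriv M (cond_measure M B) x))) \<partial>cond_measure M B)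
      = (\<integral>\<^sup>+x. ennreal (ln (prob B)) \<partial>cond_measure M B)"
    by (rule nn_integral_cong_AE) (use AE in \<open>auto elim!: eventually_mono\<close>)
  moreover have "ln (prob B) \<le> 0"
    using pos le by simp
  ultimately show ?thesis
    using ac pos C.emeasure_space_1
    by (simp add: KL_ereal_def ln_ennreal_def emeasure_eq_measure enn2ereal_ennreal ennreal_neg zero_ennreal.rep_eq)
qed

text \<open>
  Integrating \<open>ln t \<ge> 1 - 1 / t\<close> at \<open>t = M(B) dQ/dM\<close> against \<open>Q\<close> gives \<open>ln M(B) + D(Q || M) \<ge> 0\<close>,
  because \<open>dM/dQ\<close> has integral at most \<open>M(B)\<close> over \<open>B\<close>; equality forces \<open>t = 1\<close> almost everywhere.
\<close>

lemma cond_measure_if_KL_ereal_le: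
  assumes "prob_space Q" and sets [simp, measurable_cong]: "sets Q = events"
    and [measurable]: "B \<in> events" and QB: "emeasure Q B = 1"
    and le: "KL_ereal Q M \<le> - ln_ennreal (emeasure M B)" and fin: "KL_ereal Q M \<noteq> \<infinity>"
  shows "Q = cond_measure M B"
proof -
  interpret Q: prob_space Q by fact
  have ac: "absolutely_continuous M Q"
    using fin by (auto simp: KL_ereal_def split: if_splits)
  define f where "f = RN_deriv M Q"
  define g where "g x = enn2real (f x)" for x
  have [measurable]: "f \<in> borel_measurable M" "g \<in> borel_measurable M"
    unfolding g_def f_def by measurable
  have Qf: "Q = density M f"
    unfolding f_def by (rule density_RN_deriv[symmetric]) (use ac in auto)
  have "AE x in M. f x \<noteq> \<infinity>"
    unfolding f_def by (rule RN_deriv_finite) (use ac Q.sigma_finite_measure_axioms in auto)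
  \<comment> \<open>Zeros of \<open>f\<close> have no mass under \<open>density M f\<close>, so
    \<open>g\<close> is positive almost everywhere for \<open>Q\<close>, though perhaps not for
    \<open>M\<close>.\<close>
  then have "AE x in density M f. 0 < f x \<and> f x \<noteq> \<infinity>"
    by (subst AE_density) (auto elim!: eventually_mono)
  then have fg: "AE x in Q. 0 < g x \<and> f x = ennreal (g x)"
    unfolding Qf[symmetric]
    by eventually_elim (auto simp: g_def enn2real_positive_iff less_top)
  have inB: "AE x in Q. x \<in> B"
    using QB by (subst Q.AE_in_set_eq_1) (auto simp: Q.emeasure_eq_measure)
  define h where "h = prob B"
  have "B \<notin> null_sets M"
    using ac QB null_setsD1[of B Q] by (auto simp: absolutely_continuous_def)
  then have "emeasure M B \<noteq> 0" by auto
  then have h: "0 < h"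
    by (auto simp: emeasure_eq_measure h_def less_le)

  \<comment> \<open>Passing from \<open>Q\<close> to \<open>M\<close> turns \<open>1 / g\<close>
    into \<open>f * (1 / g)\<close>, almost everywhere \<open>1\<close> where \<open>g\<close> is
    positive and \<open>0\<close> where it vanishes. As \<open>M\<close> may charge zeros of
    \<open>f\<close> inside \<open>B\<close>, \<open>h\<close> is only an upper bound.\<close>
  have "(\<integral>\<^sup>+x. ennreal (1 / g x) \<partial>Q) = (\<integral>\<^sup>+x. ennreal (1 / g x) * indicator B x \<partial>Q)"
    by (rule nn_integral_cong_AE) (use inB in \<open>auto elim!: eventually_mono\<close>)
  also have "\<dots> = (\<integral>\<^sup>+x. f x * (ennreal (1 / g x) * indicator B x) \<partial>M)"
    unfolding Qf by (rule nn_integral_density) auto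
  also have "\<dots> \<le> (\<integral>\<^sup>+x. indicator B x \<partial>M)"
  proof (rule nn_integral_mono_AE)
    show "AE x in M. f x * (ennreal (1 / g x) * indicator B x) \<le> indicator B x"
      using \<open>AE x in M. f x \<noteq> \<infinity>\<close>
    proof eventually_elim
      case (elim x)
      then have "f x = ennreal (g x)" by (simp add: g_def less_top)
      moreover have "g x \<ge> 0" by (simp add: g_def)
      ultimately show ?case
        by (auto simp: ennreal_mult[symmetric] split: split_indicator)
    qed
  qed
  finally have inv_le: "(\<integral>\<^sup>+x. ennreal (1 / g x) \<partial>Q) \<le> ennreal h"
    by (simp add: emeasure_eq_measure h_def)
  then have inv_int: "integrable Q (\<lambda>x. 1 / g x)"
    by (intro integrableI_nonneg) (auto simp: g_def intro: le_less_trans)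
  have inv_le': "(\<integral>x. 1 / g x \<partial>Q) \<le> h"
    using inv_le h nn_integral_eq_integral[OF inv_int] by (auto simp: g_def)

  let ?p = "\<integral>\<^sup>+x. ennreal (ln (g x)) \<partial>Q" and ?n = "\<integral>\<^sup>+x. ennreal (- ln (g x)) \<partial>Q"
  have KL: "KL_ereal Q M = enn2ereal ?p - enn2ereal ?n"
    using ac by (simp add: KL_ereal_def g_def f_def)
  \<comment> \<open>The bound \<open>- ln g <= 1 / g - 1\<close> controls the negative part by the
    integral just estimated, which excludes infinity minus infinity in
    \<open>KL_ereal\<close>.\<close>
  have "?n \<le> (\<integral>\<^sup>+x. ennreal (1 / g x) \<partial>Q)"
  proof (rule nn_integral_mono_AE)
    show "AE x in Q. ennreal (- ln (g x)) \<le> ennreal (1 / g x)"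
      using fg
    proof eventually_elim
      case (elim x)
      then have "- ln (g x) \<le> 1 / g x - 1"
        using ln_le_minus_one[of "1 / g x"] by (simp add: ln_div)
      then show ?case by (intro ennreal_leI) simp
    qed
  qed
  then have n: "?n \<noteq> \<infinity>"
    using inv_le by (auto simp: top_unique)
  moreover have p: "?p \<noteq> \<infinity>"
    using fin n unfolding KL by (cases ?n rule: ennreal_cases) auto
  ultimately have ln_int: "integrable Q (\<lambda>x. ln (g x))"
    by (auto simp: real_integrable_def)
  have "KL_ereal Q M = ereal (\<integral>x. ln (g x) \<partial>Q)"
    unfolding KL real_lebesgue_integral_def[OF ln_int] using n p
    by (cases ?n rule: ennreal_cases; cases ?p rule: ennreal_cases) auto
  then have ln_le: "(\<integral>x. ln (g x) \<partial>Q) \<le> - ln h"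
    using le h by (simp add: ln_ennreal_def emeasure_eq_measure h_def)

  \<comment> \<open>The gap in \<open>ln t >= 1 - 1 / t\<close> at \<open>t = h * g x\<close>. It is
    nonnegative, while \<open>ln_le\<close> and \<open>inv_le'\<close> make its integral at most
    \<open>0\<close>, so it vanishes almost everywhere.\<close>
  let ?F = "\<lambda>x. ln (g x) + ln h + (1 / g x) / h - 1"
  have F_int: "integrable Q ?F"
    using ln_int inv_int by (auto simp del: divide_divide_eq_left)
  have F_nonneg: "AE x in Q. 0 \<le> ?F x"
    using fg
  proof eventually_elim
    case (elim x)
    then show ?case
      using ln_le_minus_one[of "1 / (g x * h)"] h by (simp add: ln_div ln_mult)
  qed
  have "(\<integral>x. ?F x \<partial>Q) = (\<integral>x. ln (g x) \<partial>Q) + ln h + (\<integral>x. 1 / g x \<partial>Q) / h - 1"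
    using ln_int inv_int by (simp add: Q.prob_space del: divide_divide_eq_left)
  also have "\<dots> \<le> 0"
  proof -
    have "(\<integral>x. 1 / g x \<partial>Q) / h \<le> 1" using inv_le' h by simp
    with ln_le show ?thesis by linarith
  qed
  finally have "(\<integral>x. ?F x \<partial>Q) = 0"
    using integral_nonneg_AE[OF F_nonneg] by simp
  then have "AE x in Q. ?F x = 0"
    using integral_nonneg_eq_0_iff_AE[OF F_int F_nonneg] by simp
  with fg inB have f_eq: "AE x in Q. x \<in> B \<and> f x = ennreal (1 / h)"
  proof eventually_elim
    case (elim x)
    \<comment> \<open>Equality in \<open>ln s <= s - 1\<close> occurs only at
      \<open>s = 1\<close>.\<close>
    then have "1 / (g x * h) = 1"
      using h by (intro ln_eq_minus_one) (auto simp: ln_div ln_mult)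
    then show ?case
      using elim h by (simp add: field_simps)
  qed
  show ?thesis
  proof (rule prob_measure_eqI_le)
    fix A assume "A \<in> sets Q"
    then have [measurable]: "A \<in> events" by simp
    \<comment> \<open>\<open>?E\<close> carries all of \<open>Q\<close>, and on it \<open>f\<close>
      is the conditional density. Enlarging \<open>?E\<close> to \<open>B\<close> may add mass, so
      the comparison is one-sided, which suffices for probability measures.\<close>
    let ?E = "{x \<in> space M. x \<in> B \<and> f x = ennreal (1 / h)}"
    have "AE x in Q. x \<in> A \<longleftrightarrow> x \<in> A \<inter> ?E"
      using f_eq AE_space by eventually_elim (simp add: sets_eq_imp_space_eq[OF sets])
    then have "emeasure Q A = emeasure Q (A \<inter> ?E)"
      by (rule emeasure_eq_AE) simp_all
    also have "\<dots> = (\<integral>\<^sup>+x. f x * indicator (A \<inter> ?E) x \<partial>M)"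
      unfolding Qf by (rule emeasure_density) auto
    also have "\<dots> \<le> (\<integral>\<^sup>+x. ennreal (1 / h) * indicator (A \<inter> B) x \<partial>M)"
      by (rule nn_integral_mono) (auto split: split_indicator)
    also have "\<dots> = emeasure (cond_measure M B) A"
      using h by (simp add: nn_integral_cmult emeasure_cond_measure emeasure_eq_measure
          ennreal_mult[symmetric] divide_ennreal h_def)
    finally show "emeasure Q A \<le> emeasure (cond_measure M B) A" .
  qed (use \<open>emeasure M B \<noteq> 0\<close> in \<open>auto intro: prob_space_cond_measure Q.prob_space_axioms\<close>)
qed

text \<open>A divergence below the bound would fall under the equality case and so force the
  conditional distribution, whose divergence meets the bound exactly.\<close>

lemma KL_ereal_ge:
  assumes "prob_space Q" "sets Q = events" "B \<in> events" "emeasure Q B = 1"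
  shows "- ln_ennreal (emeasure M B) \<le> KL_ereal Q M"
proof (rule ccontr)
  assume less: "\<not> - ln_ennreal (emeasure M B) \<le> KL_ereal Q M"
  then have "KL_ereal Q M \<noteq> \<infinity>" by auto
  with less assms have Q: "Q = cond_measure M B"
    by (intro cond_measure_if_KL_ereal_le) auto
  \<comment> \<open>For null \<open>B\<close> the conditional measure would give \<open>B\<close>
    mass \<open>0 / 0\<close>, which is \<open>0\<close> in \<open>ennreal\<close>, and not
    \<open>1\<close>.\<close>
  then have "emeasure M B \<noteq> 0"
    using assms by (auto simp: emeasure_cond_measure)
  with less assms show False
    unfolding Q by (simp add: KL_ereal_cond_measure)
qed

end


section \<open>The empirical Bayes posterior as a conditioned hierarchical posterior\<close>

text \<open>A finite sum has only finitely many terms above a positive level, so a largest term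
  exists even for infinite \<open>K\<close>.\<close>

lemma ex_is_arg_max_of_finite_nn_integral:
  fixes w :: "'k \<Rightarrow> ennreal"
  assumes "0 < (\<integral>\<^sup>+k. w k \<partial>count_space K)" "(\<integral>\<^sup>+k. w k \<partial>count_space K) < \<infinity>"
  shows "\<exists>k. is_arg_max w (\<lambda>k. k \<in> K) k"
proof -
  obtain k0 where k0: "k0 \<in> K" "0 < w k0"
  proof (rule ccontr)
    assume "\<not> thesis"
    then have "\<And>k. k \<in> K \<Longrightarrow> w k = 0" using that by (auto simp: zero_less_iff_neq_zero)
    then have "(\<integral>\<^sup>+k. w k \<partial>count_space K) = (\<integral>\<^sup>+k. 0 \<partial>count_space K)"
      by (intro nn_integral_cong) simp
    with assms show False by simp
  qed
  let ?L = "{k \<in> K. w k0 \<le> w k}"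
  \<comment> \<open>Markov's inequality at the positive level \<open>w k0\<close> bounds the number
    of indices in \<open>?L\<close>.\<close>
  have "w k0 * emeasure (count_space K) ?L = (\<integral>\<^sup>+k. w k0 * indicator ?L k \<partial>count_space K)"
    by (simp add: nn_integral_cmult)
  also have "\<dots> \<le> (\<integral>\<^sup>+k. w k \<partial>count_space K)"
    by (rule nn_integral_mono) (auto split: split_indicator)
  finally have "emeasure (count_space K) ?L \<noteq> \<infinity>"
    using assms k0 by (auto simp: ennreal_mult_top top_unique split: if_splits)
  then have "finite ?L"
    by (auto simp: emeasure_count_space split: if_splits)
  moreover have "k0 \<in> ?L" using k0 by simp
  ultimately obtain k where k: "k \<in> ?L" "w k = Max (w ` ?L)"
    using Max_in[of "w ` ?L"] by fastforce
  have "w l \<le> w k" if "l \<in> K" for l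
  proof (cases "l \<in> ?L")
    case True
    with k \<open>finite ?L\<close> show ?thesis by simp
  next
    case False
    with that k(1) show ?thesis by (auto simp: not_le intro: order.strict_implies_order order.strict_trans2)
  qed
  with k have "is_arg_max w (\<lambda>k. k \<in> K) k"
    by (auto simp: is_arg_max_linorder)
  then show ?thesis ..
qed

section \<open>Measurability of the parts and support of the embedded priors\<close>

lemma Xi_part_sets:
  assumes "k \<in> K"
  shows "Xi_part K Theta k \<in> sets (Xi_space K Theta)"
proof -
  have "Xi_embed K l -` Xi_part K Theta k \<inter> space (Theta l) = (if l = k then space (Theta l) else {})"
    if "l \<in> K" for l
    using that assms by (auto simp: Xi_part_def Xi_embed_def split: if_splits)
  then show ?thesis
    using assms by (auto simp: sets_Xi_space Xi_set_def)
qed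

lemma sets_prior_bar [simp, measurable_cong]:
  "sets (prior_bar K Theta prior k) = sets (Xi_space K Theta)"
  by (simp add: prior_bar_def)

lemma sets_hier_posterior [simp, measurable_cong]:
  "sets (hier_posterior K Theta p X prior \<pi>) = sets (Xi_space K Theta)"
  using sets.sigma_algebra_axioms[of "Xi_space K Theta"]
  by (simp add: hier_posterior_def sigma_algebra.sets_measure_of_eq)

lemma space_hier_posterior [simp]:
  "space (hier_posterior K Theta p X prior \<pi>) = Xi_set K Theta"
  using sets_eq_imp_space_eq[OF sets_hier_posterior] by simp

lemma AE_prior_bar_Xi_part:
  assumes "k \<in> K" "sets (prior k) = sets (Theta k)"
  shows "AE \<xi> in prior_bar K Theta prior k. \<xi> \<in> Xi_part K Theta k"
proof -
  have "Xi_embed K k \<in> measurable (prior k) (Xi_space K Theta)"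
    using measurable_Xi_embed[OF assms(1)] assms(2) by (simp cong: measurable_cong_sets)
  moreover have "AE \<theta> in prior k. Xi_embed K k \<theta> \<in> Xi_part K Theta k"
    using bij_betwE[OF bij_betw_Xi_embed[OF assms(1), of Theta]] sets_eq_imp_space_eq[OF assms(2)]
    by (auto intro!: AE_I2)
  ultimately show ?thesis
    using sets.Int[OF sets.top Xi_part_sets[OF assms(1), of Theta]]
    unfolding prior_bar_def by (subst AE_distr_iff) (auto simp: Int_def)
qed

section \<open>Posterior probabilities of the individual models\<close>

context
  fixes K :: "'k set"
    and Theta :: "'k \<Rightarrow> 'a measure"
    and p :: "'k \<Rightarrow> 'a \<Rightarrow> 'x \<Rightarrow> real"
    and prior :: "'k \<Rightarrow> 'a measure"
    and \<pi> :: "'k pmf"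
    and X :: 'x
  assumes lik_meas: "\<And>k. k \<in> K \<Longrightarrow> (\<lambda>\<theta>. p k \<theta> X) \<in> borel_measurable (Theta k)"
    and prior_sets: "\<And>k. k \<in> K \<Longrightarrow> sets (prior k) = sets (Theta k)"
    and ev_pos: "0 < hier_evidence K Theta p X prior \<pi>"
    and ev_fin: "hier_evidence K Theta p X prior \<pi> < \<infinity>"
begin

abbreviation (input) "post \<equiv> hier_posterior K Theta p X prior \<pi>"

lemma prob_space_hier_posterior: "prob_space post"
proof
  have "(\<integral>\<^sup>+ \<xi>\<in>Xi_set K Theta. ennreal (Xi_lik K p X \<xi>) \<partial>prior_bar K Theta prior k)
      = evidence K Theta p X prior k" for k
    unfolding evidence_def
    by (rule nn_integral_cong) (simp add: prior_bar_def)
  then have "emeasure post (Xi_set K Theta)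
      = hier_evidence K Theta p X prior \<pi> / hier_evidence K Theta p X prior \<pi>"
    using sets.top[of "Xi_space K Theta"]
    by (subst emeasure_hier_posterior[where X = X and p = p, OF lik_meas])
      (auto simp: hier_evidence_def)
  then show "emeasure post (space post) = 1"
    using ev_pos ev_fin by simp
qed

text \<open>The embedded prior of any other index lives on a part disjoint from that of
  \<open>k\<close>, so a single summand survives.\<close>

lemma emeasure_hier_posterior_Int_Xi_part:
  assumes k: "k \<in> K" and A [measurable]: "A \<in> sets (Xi_space K Theta)"
  shows "emeasure post (A \<inter> Xi_part K Theta k) =
    ennreal (pmf \<pi> k) * (\<integral>\<^sup>+ \<xi>\<in>A. ennreal (Xi_lik K p X \<xi>) \<partial>prior_bar K Theta prior k)
      / hier_evidence K Theta p X prior \<pi>"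
proof -
  let ?I = "\<lambda>B l. \<integral>\<^sup>+ \<xi>\<in>B. ennreal (Xi_lik K p X \<xi>) \<partial>prior_bar K Theta prior l"
  have I: "?I (A \<inter> Xi_part K Theta k) l = (if l = k then ?I A k else 0)" if l: "l \<in> K" for l
  proof -
    have "?I (A \<inter> Xi_part K Theta k) l
        = (\<integral>\<^sup>+ \<xi>. (if l = k then ennreal (Xi_lik K p X \<xi>) * indicator A \<xi> else 0)
            \<partial>prior_bar K Theta prior l)"
    proof (rule nn_integral_cong_AE)
      show "AE \<xi> in prior_bar K Theta prior l.
          ennreal (Xi_lik K p X \<xi>) * indicator (A \<inter> Xi_part K Theta k) \<xi>
            = (if l = k then ennreal (Xi_lik K p X \<xi>) * indicator A \<xi> else 0)"
        using AE_prior_bar_Xi_part[where Theta = Theta and prior = prior, OF l prior_sets[OF l]]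
        by eventually_elim
          (use disjoint_family_onD[OF disjoint_Xi_part l k, of Theta] in
            \<open>auto split: split_indicator\<close>)
    qed
    then show ?thesis by (cases "l = k") auto
  qed
  have "(\<integral>\<^sup>+ l. ennreal (pmf \<pi> l) * ?I (A \<inter> Xi_part K Theta k) l \<partial>count_space K)
      = (\<integral>\<^sup>+ l. (ennreal (pmf \<pi> k) * ?I A k) * indicator {k} l \<partial>count_space K)"
    by (rule nn_integral_cong) (auto simp: I)
  also have "\<dots> = ennreal (pmf \<pi> k) * ?I A k"
    using k by (subst nn_integral_cmult_indicator) auto
  finally show ?thesis
    using Xi_part_sets[OF k, of Theta] A
    by (subst emeasure_hier_posterior[where X = X and p = p, OF lik_meas]) auto
qed

lemma emeasure_hier_posterior_Xi_part:
  assumes k: "k \<in> K"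
  shows "emeasure post (Xi_part K Theta k) =
    ennreal (pmf \<pi> k) * evidence K Theta p X prior k / hier_evidence K Theta p X prior \<pi>"
proof -
  have "(\<integral>\<^sup>+ \<xi>\<in>Xi_set K Theta. ennreal (Xi_lik K p X \<xi>) \<partial>prior_bar K Theta prior k)
      = evidence K Theta p X prior k"
    unfolding evidence_def
    by (rule nn_integral_cong) (simp add: prior_bar_def)
  moreover have "Xi_set K Theta \<inter> Xi_part K Theta k = Xi_part K Theta k"
    using k by (auto simp: Xi_set_def)
  ultimately show ?thesis
    using emeasure_hier_posterior_Int_Xi_part[OF k, of "Xi_set K Theta"]
      sets.top[of "Xi_space K Theta"] by simp
qed

text \<open>Division by a constant strictly between \<open>0\<close> and infinity and the strictly
  increasing \<open>ln_ennreal\<close> both preserve and reflect order. Maximizing the objective is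
  thus choosing the most probable model.\<close>

lemma emeasure_hier_posterior_Xi_part_le_iff:
  assumes "k \<in> K" "l \<in> K"
  shows "emeasure post (Xi_part K Theta k) \<le> emeasure post (Xi_part K Theta l) \<longleftrightarrow>
    EB_objective K Theta p X prior \<pi> k \<le> EB_objective K Theta p X prior \<pi> l"
proof -
  have "a / c \<le> b / c \<longleftrightarrow> a \<le> b" if "0 < c" "c < \<infinity>" for a b c :: ennreal
  proof
    assume "a / c \<le> b / c"
    then have "a / c * c \<le> b / c * c" by (rule mult_right_mono) simp
    then show "a \<le> b" using that by (simp add: ennreal_divide_times ennreal_mult_divide_eq)
  qed (rule divide_right_mono_ennreal)
  then show ?thesis
    using assms ev_pos ev_fin by (simp add: emeasure_hier_posterior_Xi_part EB_objective_def)
qed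

text \<open>Restricted to one part, the hierarchical posterior is likelihood times prior up to the
  factor \<open>pmf \<pi> k\<close> over the normalizing constant; conditioning cancels that
  factor.\<close>

lemma EB_posterior_eq_cond_measure:
  assumes k: "k \<in> K" and nz: "emeasure post (Xi_part K Theta k) \<noteq> 0"
  shows "EB_posterior K Theta p X prior k = cond_measure post (Xi_part K Theta k)"
proof (rule measure_eqI)
  interpret prob_space post by (rule prob_space_hier_posterior)
  note [measurable] = measurable_Xi_lik[of K p X Theta, OF lik_meas]
  fix A assume "A \<in> sets (EB_posterior K Theta p X prior k)"
  then have A [measurable]: "A \<in> sets (Xi_space K Theta)" by (simp add: EB_posterior_def)
  let ?W = "hier_evidence K Theta p X prior \<pi>" and ?e = "evidence K Theta p X prior k"
  let ?I = "\<integral>\<^sup>+ \<xi>\<in>A. ennreal (Xi_lik K p X \<xi>) \<partial>prior_bar K Theta prior k"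
  have "emeasure post (Xi_part K Theta k) < \<infinity>" by (simp add: less_top[symmetric])
  then have fin: "ennreal (pmf \<pi> k) * ?e < \<infinity>" "0 < ennreal (pmf \<pi> k) * ?e"
    using nz ev_pos ev_fin
    by (auto simp: emeasure_hier_posterior_Xi_part[OF k] ennreal_divide_eq_top_iff
        zero_less_iff_neq_zero less_top[symmetric])
  have "emeasure (EB_posterior K Theta p X prior k) A
      = (\<integral>\<^sup>+ \<xi>. inverse ?e * (ennreal (Xi_lik K p X \<xi>) * indicator A \<xi>) \<partial>prior_bar K Theta prior k)"
    by (auto simp: EB_posterior_def emeasure_density divide_ennreal_def mult_ac
        intro!: nn_integral_cong)
  also have "\<dots> = ?I / ?e"
    by (subst nn_integral_cmult) (auto simp: divide_ennreal_def mult.commute)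
  also have "\<dots> = (ennreal (pmf \<pi> k) * ?I / ?W) / (ennreal (pmf \<pi> k) * ?e / ?W)"
  proof -
    \<comment> \<open>Cancellation in \<open>ennreal\<close> is applied to finite nonzero factors:
      \<open>c\<close> is the prior weight and \<open>d\<close> the normalizing constant. No
      condition falls on \<open>a\<close> and \<open>b\<close>.\<close>
    have cancel: "a / b = (c * a / d) / (c * b / d)"
      if "c \<noteq> 0" "c \<noteq> \<infinity>" "d \<noteq> 0" "d \<noteq> \<infinity>" for a b c d :: ennreal
    proof -
      have "(c * a / d) / (c * b / d) = (c * a * inverse d) / (c * b * inverse d)"
        by (simp only: divide_ennreal_def[of _ d])
      also have "\<dots> = (c * a) / (c * b)"
        using that by (intro divide_mult_eq) auto
      also have "\<dots> = (a * c) / (b * c)"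
        by (simp only: mult.commute)
      also have "\<dots> = a / b"
        using that by (intro divide_mult_eq) auto
      finally show ?thesis ..
    qed
    have "ennreal (pmf \<pi> k) \<noteq> 0"
      using fin(2) by (intro notI) simp
    then show ?thesis
      using ev_pos ev_fin by (intro cancel) auto
  qed
  also have "\<dots> = emeasure (cond_measure post (Xi_part K Theta k)) A"
    using k by (simp add: emeasure_cond_measure Xi_part_sets emeasure_hier_posterior_Int_Xi_part
        emeasure_hier_posterior_Xi_part)
  finally show "emeasure (EB_posterior K Theta p X prior k) A
      = emeasure (cond_measure post (Xi_part K Theta k)) A" .
qed (simp add: EB_posterior_def)

section \<open>Maximizers of the objective and minimizers of the divergence\<close>

lemma ex_is_arg_max_EB_objective: "\<exists>k. is_arg_max (EB_objective K Theta p X prior \<pi>) (\<lambda>k. k \<in> K) k"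
  \<comment> \<open>The products of prior weight and evidence sum to the hierarchical evidence, and
    \<open>ln_ennreal\<close> preserves their maximizers.\<close>
  using ex_is_arg_max_of_finite_nn_integral[OF ev_pos[unfolded hier_evidence_def]
      ev_fin[unfolded hier_evidence_def]]
  by (simp add: is_arg_max_def EB_objective_def)

text \<open>If the largest posterior weight were \<open>0\<close>, all weights would be, and the
  hierarchical evidence would vanish.\<close>

lemma EB_objective_max_pos:
  assumes "is_arg_max (EB_objective K Theta p X prior \<pi>) (\<lambda>k. k \<in> K) k"
  shows "emeasure post (Xi_part K Theta k) \<noteq> 0"
proof
  assume "emeasure post (Xi_part K Theta k) = 0"
  then have "emeasure post (Xi_part K Theta l) = 0" if "l \<in> K" for l
    using assms that emeasure_hier_posterior_Xi_part_le_iff[of l k]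
    by (auto simp: is_arg_max_linorder)
  then have "ennreal (pmf \<pi> l) * evidence K Theta p X prior l = 0" if "l \<in> K" for l
    using that less_imp_neq[OF ev_fin] emeasure_hier_posterior_Xi_part[OF that]
    by (metis ennreal_divide_eq_0_iff infinity_ennreal_def)
  then have "hier_evidence K Theta p X prior \<pi> = (\<integral>\<^sup>+ k. 0 \<partial>count_space K)"
    unfolding hier_evidence_def by (intro nn_integral_cong) simp
  with ev_pos show False by simp
qed

text \<open>The part on which \<open>Q\<close> is concentrated serves as the event in the entropy
  bound.\<close>

lemma KL_ereal_S_EB_ge:
  assumes "Q \<in> S_EB K Theta"
  obtains k where "k \<in> K" "emeasure Q (Xi_part K Theta k) = 1"
    "- ln_ennreal (emeasure post (Xi_part K Theta k)) \<le> KL_ereal Q post"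
proof -
  interpret prob_space post by (rule prob_space_hier_posterior)
  obtain k where k: "k \<in> K" "measure Q (Xi_part K Theta k) = 1"
    and Q: "prob_space Q" "sets Q = sets (Xi_space K Theta)"
    using assms by (auto simp: S_EB_def)
  interpret Q: prob_space Q by fact
  have "emeasure Q (Xi_part K Theta k) = 1"
    using k by (simp add: Q.emeasure_eq_measure)
  with k Q show ?thesis
    by (intro that[of k] KL_ereal_ge) (auto simp: Xi_part_sets)
qed

text \<open>A competitor on part \<open>k\<close> has divergence at least
  \<open>- ln_ennreal (?h k)\<close>, which is smallest at \<open>khat\<close>, where conditioning
  attains it. Uniqueness comes from the equality case of the entropy bound.\<close>

lemma is_arg_min_EB_posterior:
  assumes khat: "is_arg_max (EB_objective K Theta p X prior \<pi>) (\<lambda>k. k \<in> K) khat"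
  shows "is_arg_min (\<lambda>Q. KL_ereal Q post) (\<lambda>Q. Q \<in> S_EB K Theta) (EB_posterior K Theta p X prior khat)"
    and "\<lbrakk>\<And>k. is_arg_max (EB_objective K Theta p X prior \<pi>) (\<lambda>k. k \<in> K) k \<Longrightarrow> k = khat;
          is_arg_min (\<lambda>Q. KL_ereal Q post) (\<lambda>Q. Q \<in> S_EB K Theta) Q\<rbrakk>
         \<Longrightarrow> Q = EB_posterior K Theta p X prior khat"
proof -
  interpret prob_space post by (rule prob_space_hier_posterior)
  let ?h = "\<lambda>k. emeasure post (Xi_part K Theta k)"
  let ?EB = "EB_posterior K Theta p X prior khat"
  have max: "?h k \<le> ?h khat" if "k \<in> K" for k
    using khat that emeasure_hier_posterior_Xi_part_le_iff[of k khat]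
    by (auto simp: is_arg_max_linorder)
  have K: "khat \<in> K" using khat by (auto simp: is_arg_max_def)
  note nz = EB_objective_max_pos[OF khat]
  note EB = EB_posterior_eq_cond_measure[OF K nz]
  note meas = Xi_part_sets[where Theta = Theta, OF K]
  have KL_EB: "KL_ereal ?EB post = - ln_ennreal (?h khat)"
    unfolding EB using nz meas by (intro KL_ereal_cond_measure) auto
  interpret EB: prob_space ?EB
    unfolding EB using nz meas by (intro prob_space_cond_measure) auto
  have "emeasure ?EB (Xi_part K Theta khat) = 1"
    unfolding EB using meas nz by (subst emeasure_cond_measure) (auto simp: less_top[symmetric])
  then have EB_in: "?EB \<in> S_EB K Theta"
    using K EB.prob_space_axioms by (auto simp: S_EB_def EB_posterior_def measure_def)
  show arg_min: "is_arg_min (\<lambda>Q. KL_ereal Q post) (\<lambda>Q. Q \<in> S_EB K Theta) ?EB"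
    unfolding is_arg_min_linorder
  proof (intro conjI allI impI EB_in)
    fix Q assume "Q \<in> S_EB K Theta"
    then obtain k where "k \<in> K" "- ln_ennreal (?h k) \<le> KL_ereal Q post"
      by (rule KL_ereal_S_EB_ge)
    moreover from this have "- ln_ennreal (?h khat) \<le> - ln_ennreal (?h k)"
      using max by simp
    ultimately show "KL_ereal ?EB post \<le> KL_ereal Q post"
      unfolding KL_EB by order
  qed
  assume unique: "\<And>k. is_arg_max (EB_objective K Theta p X prior \<pi>) (\<lambda>k. k \<in> K) k \<Longrightarrow> k = khat"
    and "is_arg_min (\<lambda>Q. KL_ereal Q post) (\<lambda>Q. Q \<in> S_EB K Theta) Q"
  then have Q: "Q \<in> S_EB K Theta" and KL_Q: "KL_ereal Q post \<le> - ln_ennreal (?h khat)"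
    using EB_in by (auto simp: is_arg_min_linorder simp flip: KL_EB)
  \<comment> \<open>The part carrying a minimizer must itself have maximal posterior weight: its
    lower bound cannot exceed the minimal value.\<close>
  from Q obtain k where k: "k \<in> K" "emeasure Q (Xi_part K Theta k) = 1"
      "- ln_ennreal (?h k) \<le> KL_ereal Q post"
    by (rule KL_ereal_S_EB_ge)
  then have "- ln_ennreal (?h k) \<le> - ln_ennreal (?h khat)"
    using KL_Q by order
  then have "EB_objective K Theta p X prior \<pi> khat \<le> EB_objective K Theta p X prior \<pi> k"
    using k K emeasure_hier_posterior_Xi_part_le_iff[of khat k] by simp
  then have "is_arg_max (EB_objective K Theta p X prior \<pi>) (\<lambda>k. k \<in> K) k"
    using khat k(1) unfolding is_arg_max_linorder by (meson order_trans)
  then have "k = khat" by (rule unique)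
  \<comment> \<open>\<open>?h khat\<close> is nonzero, so the minimal value is finite, as the
    equality case demands.\<close>
  moreover have "KL_ereal Q post \<noteq> \<infinity>"
    using KL_Q nz ln_ennreal_eq_infty_iff[of "?h khat"] by auto
  ultimately show "Q = ?EB"
    unfolding EB using Q k KL_Q meas
    by (intro cond_measure_if_KL_ereal_le) (auto simp: S_EB_def)
qed

end

theorem proposition3p2:
  fixes K :: "'k set"
    and Theta :: "'k \<Rightarrow> 'a measure"
    and \<mu> :: "'x measure"
    and P :: "'k \<Rightarrow> 'a \<Rightarrow> 'x measure"
    and p :: "'k \<Rightarrow> 'a \<Rightarrow> 'x \<Rightarrow> real"
    and prior :: "'k \<Rightarrow> 'a measure"
    and \<pi> :: "'k pmf"
    and X :: 'x
  assumes "countable K"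
    and "\<And>k \<theta>. k \<in> K \<Longrightarrow> \<theta> \<in> space (Theta k) \<Longrightarrow> prob_space (P k \<theta>)"
    and "\<And>k \<theta>. k \<in> K \<Longrightarrow> \<theta> \<in> space (Theta k) \<Longrightarrow> p k \<theta> \<in> borel_measurable \<mu>"
    and "\<And>k \<theta> x. k \<in> K \<Longrightarrow> \<theta> \<in> space (Theta k) \<Longrightarrow> x \<in> space \<mu> \<Longrightarrow> 0 \<le> p k \<theta> x"
    and "\<And>k \<theta>. k \<in> K \<Longrightarrow> \<theta> \<in> space (Theta k) \<Longrightarrow> P k \<theta> = density \<mu> (\<lambda>x. ennreal (p k \<theta> x))"
    and "X \<in> space \<mu>"
    and "\<And>k. k \<in> K \<Longrightarrow> (\<lambda>\<theta>. p k \<theta> X) \<in> borel_measurable (Theta k)"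
    and "\<And>k. k \<in> K \<Longrightarrow> prob_space (prior k)"
    and "\<And>k. k \<in> K \<Longrightarrow> sets (prior k) = sets (Theta k)"
    and "set_pmf \<pi> \<subseteq> K"
    and "0 < hier_evidence K Theta p X prior \<pi>"
    and "hier_evidence K Theta p X prior \<pi> < \<infinity>"
  shows "(\<exists>k. is_arg_max (EB_objective K Theta p X prior \<pi>) (\<lambda>k. k \<in> K) k) \<and>
    (\<forall>khat. is_arg_max (EB_objective K Theta p X prior \<pi>) (\<lambda>k. k \<in> K) khat \<longrightarrow>
       is_arg_min (\<lambda>Q. KL_ereal Q (hier_posterior K Theta p X prior \<pi>)) (\<lambda>Q. Q \<in> S_EB K Theta)
         (EB_posterior K Theta p X prior khat) \<and>
       ((\<forall>k. is_arg_max (EB_objective K Theta p X prior \<pi>) (\<lambda>k. k \<in> K) k \<longrightarrow> k = khat) \<longrightarrow>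
          (\<forall>Q. is_arg_min (\<lambda>Q. KL_ereal Q (hier_posterior K Theta p X prior \<pi>)) (\<lambda>Q. Q \<in> S_EB K Theta) Q
             \<longrightarrow> Q = EB_posterior K Theta p X prior khat)))"
  using ex_is_arg_max_EB_objective[OF assms(7,9,11,12)]
    is_arg_min_EB_posterior[OF assms(7,9,11,12)] by blast

end
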